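(* Let $a<b$ be real numbers. There exist a Lebesgue integrable, essentially unbounded exponent $p:[a,b]\to[1,+\infty)$ and a function $f\in WBV_{p(\cdot)}[a,b]$ such that the set of points of discontinuity of $f$ has the cardinality of the continuum.
   Context: For a nondegenerate closed interval $Q=[s,t]\subset[a,b]$ put $f(Q):=f(t)-f(s)$, $|Q|=t-s$, and $\bar p(Q):=\left(\frac{1}{|Q|}\int_Q\frac{1}{p(x)}\,dx\right)^{-1}$. A finite partition of $[a,b]$ is a family $P=\{Q_k\}_{k=1}^n$ with $Q_k=[t_{k-1},t_k]$ and $a=t_0<\dots<t_n=b$; $\Pi[a,b]$ is the set of all finite partitions. Define $$V_a^b(p,f):=\sup_{P\in\Pi[a,b]}\sum_{k=1}^n|f(Q_k)|^{\bar p(Q_k)}\in[0,+\infty],$$ $$\|f\|_{WBV_{p(\cdot)}}:=\inf\{\lambda>0: V_a^b(p,f/\lambda)\le 1\}\quad(\inf\emptyset=+\infty),$$ $$WBV_{p(\cdot)}[a,b]:=\{f:[a,b]\to\mathbb{R}: f(a)=0,\ \|f\|_{WBV_{p(\cdot)}}<+\infty\}.$$ "Essentially unbounded" means not essentially bounded, i.e. $\operatorname{ess\,sup} p=+\infty$. *)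

theory Defs
  imports "HOL-Analysis.Analysis" "HOL-Probability.Essential_Supremum" "HOL-Library.Equipollence"
begin

text \<open>Functions on \<open>[a,b]\<close> are represented by total functions on the reals; none of the
  notions below depends on values outside \<open>[a,b]\<close>.\<close>

definition mean_exponent :: "(real \<Rightarrow> real) \<Rightarrow> real \<Rightarrow> real \<Rightarrow> real" where
  "mean_exponent p s t =
     inverse (1 / (t - s) * set_lebesgue_integral lebesgue {s..t} (\<lambda>x. 1 / p x))"

text \<open>A pair \<open>(n, t)\<close> encodes the partition with division points \<open>t 0 < \<dots> < t n\<close>; the values
  of \<open>t\<close> beyond \<open>n\<close> are irrelevant.\<close>

definition partitions :: "real \<Rightarrow> real \<Rightarrow> (nat \<times> (nat \<Rightarrow> real)) set" where
  "partitions a b = {(n, t). t 0 = a \<and> t n = b \<and> (\<forall>k<n. t k < t (Suc k))}"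

definition var_exp_variation ::
    "real \<Rightarrow> real \<Rightarrow> (real \<Rightarrow> real) \<Rightarrow> (real \<Rightarrow> real) \<Rightarrow> ennreal" where
  "var_exp_variation a b p f =
     (SUP (n, t) \<in> partitions a b.
        \<Sum>k<n. ennreal (\<bar>f (t (Suc k)) - f (t k)\<bar> powr mean_exponent p (t k) (t (Suc k))))"

text \<open>The infimum is taken in the extended reals, so it is \<open>\<infinity>\<close> when no \<open>\<lambda>\<close> is admissible.\<close>

definition wbv_norm :: "real \<Rightarrow> real \<Rightarrow> (real \<Rightarrow> real) \<Rightarrow> (real \<Rightarrow> real) \<Rightarrow> ennreal" where
  "wbv_norm a b p f =
     Inf {ennreal l | l. 0 < l \<and> var_exp_variation a b p (\<lambda>x. f x / l) \<le> 1}"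

definition WBV :: "real \<Rightarrow> real \<Rightarrow> (real \<Rightarrow> real) \<Rightarrow> (real \<Rightarrow> real) set" where
  "WBV a b p = {f. f a = 0 \<and> wbv_norm a b p f < \<infinity>}"

definition discontinuities :: "real \<Rightarrow> real \<Rightarrow> (real \<Rightarrow> real) \<Rightarrow> real set" where
  "discontinuities a b f = {x \<in> {a..b}. \<not> continuous (at x within {a..b}) f}"

end

theory Submission
  imports Defs
begin

text \<open>
  A function of finite variation with a constant exponent has only countably many
  discontinuities. An unbounded exponent can destroy this, because a jump costs next to nothing
  where the exponent is huge. Take \<open>f\<close> to be the indicator of a Cantor-like set \<open>C\<close> of the
  cardinality of the continuum; since \<open>C\<close> is null it contains no interval, so \<open>f\<close> is
  discontinuous at each point of \<open>C\<close>. Only the intervals \<open>Q\<close> of a partition with exactly one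
  endpoint in \<open>C\<close> contribute to the variation of \<open>f / 4\<close>, and they contribute
  \<open>(1/4) powr pbar Q\<close>, where \<open>pbar Q\<close> is the mean exponent of \<open>Q\<close>. If \<open>p \<ge> n + 1\<close> almost
  everywhere within distance \<open>(b - a) / 4 ^ n\<close> of \<open>C\<close>, for all \<open>n\<close>, then such an interval
  satisfies \<open>(1/4) powr pbar Q \<le> \<bar>Q\<bar> / (b - a)\<close>, and these bounds add up to at most \<open>1\<close> however
  many intervals touch \<open>C\<close>.

  It thus suffices that \<open>p\<close> grows like the logarithm of the inverse distance to \<open>C\<close>. It remains integrable if
  the neighbourhoods of \<open>C\<close> of radius \<open>(b - a) / 4 ^ n\<close> have summable measures: then \<open>p\<close> can be
  one plus the number of these neighbourhoods that contain the given point. A set \<open>C\<close> of sums of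
  distinct powers \<open>1 / 4 ^ (i + 1)\<close> has this property, because at scale \<open>1 / 4 ^ n\<close> it is covered
  by \<open>2 ^ n\<close> intervals, of total length of order \<open>1 / 2 ^ n\<close>.
\<close>

section \<open>Mean exponents and null sets\<close>

lemma AE_lebesgue_obtains_in_interval:
  fixes s t :: real
  assumes "AE x in lebesgue. P x" "s < t"
  obtains x where "s \<le> x" "x \<le> t" "P x"
proof (rule ccontr)
  assume "\<not> thesis"
  then have "\<not> P x" if "x \<in> {s..t}" for x
    using that \<open>\<And>x. \<lbrakk>s \<le> x; x \<le> t; P x\<rbrakk> \<Longrightarrow> thesis\<close> by auto
  with assms(1) have "AE x in lebesgue. x \<notin> {s..t}"
    by (auto elim!: eventually_mono)
  then have "{s..t} \<in> null_sets lebesgue"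
    by (subst (asm) AE_iff_null_sets[symmetric]) auto
  then have "emeasure lebesgue {s..t} = 0"
    by (rule null_setsD1)
  with \<open>s < t\<close> show False
    by simp
qed

text \<open>The harmonic mean of a function is at least any lower bound of it. That the
  integral of \<open>1 / p\<close> does not vanish matters, because the inverse of zero is zero.\<close>

lemma mean_exponent_ge:
  assumes [measurable]: "p \<in> borel_measurable lebesgue"
    and "s < t" "0 < m"
    and ge: "AE x in lebesgue. x \<in> {s..t} \<longrightarrow> m \<le> p x"
  shows "m \<le> mean_exponent p s t"
proof -
  let ?g = "\<lambda>x. indicator {s..t} x *\<^sub>R (1 / p x)"
  have "AE x in lebesgue. x \<in> {s..t} \<longrightarrow> norm (1 / p x) \<le> 1 / m"
    using ge
  proof eventually_elim
    case (elim x)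
    then show ?case
      using \<open>0 < m\<close> by (auto intro!: divide_left_mono)
  qed
  then have int: "integrable lebesgue ?g"
    by (intro integrableI_bounded_set_indicator) (auto simp: emeasure_lborel_Icc_eq)
  have nonneg: "AE x in lebesgue. 0 \<le> ?g x"
    using ge by eventually_elim (use \<open>0 < m\<close> in \<open>auto simp: indicator_def\<close>)
  have "integral\<^sup>L lebesgue ?g \<noteq> 0"
  proof
    assume "integral\<^sup>L lebesgue ?g = 0"
    then have "AE x in lebesgue. ?g x = 0"
      using integral_nonneg_eq_0_iff_AE[OF int nonneg] by simp
    with ge have "AE x in lebesgue. x \<notin> {s..t}"
      by eventually_elim (use \<open>0 < m\<close> in \<open>auto simp: indicator_def\<close>)
    then obtain x where "s \<le> x" "x \<le> t" "x \<notin> {s..t}"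
      using \<open>s < t\<close> by (rule AE_lebesgue_obtains_in_interval)
    then show False
      by auto
  qed
  moreover have "0 \<le> integral\<^sup>L lebesgue ?g"
    using nonneg by (rule integral_nonneg_AE)
  ultimately have pos: "0 < integral\<^sup>L lebesgue ?g"
    by simp
  have "integral\<^sup>L lebesgue ?g \<le> integral\<^sup>L lebesgue (\<lambda>x. indicator {s..t} x *\<^sub>R (1 / m))"
  proof (rule integral_mono_AE[OF int])
    show "integrable lebesgue (\<lambda>x. indicator {s..t} x *\<^sub>R (1 / m))"
      by (rule integrable_scaleR_left) (auto simp: integrable_indicator_iff emeasure_lborel_Icc_eq)
    show "AE x in lebesgue. ?g x \<le> indicator {s..t} x *\<^sub>R (1 / m)"
      using ge by eventually_elim
        (use \<open>0 < m\<close> in \<open>auto simp: indicator_def intro!: divide_left_mono\<close>)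
  qed
  also have "\<dots> = (t - s) / m"
    using \<open>s < t\<close> by simp
  finally have "integral\<^sup>L lebesgue ?g \<le> (t - s) / m" .
  with pos \<open>s < t\<close> \<open>0 < m\<close> show ?thesis
    unfolding mean_exponent_def set_lebesgue_integral_def
    by (simp add: field_simps)
qed

section \<open>The exponent of a set with thin neighbourhoods\<close>

text \<open>\<open>U n\<close> is a neighbourhood of \<open>C\<close> at the scale \<open>1 / 4 ^ n\<close>. Counting these
  neighbourhoods at each point gives a function whose integral is the sum of their measures. The point \<open>a\<close>
  is kept out of \<open>C\<close> so that the indicator of \<open>C\<close> vanishes there.\<close>

locale thin_neighbourhoods =
  fixes a b :: real and C :: "real set" and U :: "nat \<Rightarrow> real set"
  assumes less: "a < b"
    and C_subset: "C \<subseteq> {a<..b}"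
    and C_nonempty: "C \<noteq> {}"
    and sets_U [measurable]: "\<And>n. U n \<in> sets lebesgue"
    and summable_U: "(\<Sum>n. emeasure lebesgue (U n)) < \<infinity>"
    and cball_U: "\<And>c n. c \<in> C \<Longrightarrow> cball c ((b - a) * (1 / 4) ^ n) \<subseteq> U n"
begin

definition multiplicity :: "real \<Rightarrow> ennreal" where
  "multiplicity x = (\<Sum>n. indicator (U n) x)"

text \<open>The exponent is \<open>1\<close> where the multiplicity is infinite, in particular on \<open>C\<close> itself. This
  happens only on a null set, which the mean exponents do not see.\<close>

definition exponent :: "real \<Rightarrow> real" where
  "exponent x = 1 + enn2real (multiplicity x)"

lemma measurable_multiplicity [measurable]: "multiplicity \<in> borel_measurable lebesgue"
  unfolding multiplicity_def by measurable

lemma measurable_exponent [measurable]: "exponent \<in> borel_measurable lebesgue"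
  unfolding exponent_def by measurable

lemma nn_integral_multiplicity: "(\<integral>\<^sup>+x. multiplicity x \<partial>lebesgue) < \<infinity>"
  unfolding multiplicity_def using summable_U by (simp add: nn_integral_suminf)

lemma AE_multiplicity_finite: "AE x in lebesgue. multiplicity x \<noteq> \<infinity>"
  using nn_integral_multiplicity by (intro nn_integral_PInf_AE) auto

lemma integrable_exponent: "integrable (lebesgue_on {a..b}) exponent"
proof -
  have "integrable lebesgue (\<lambda>x. enn2real (multiplicity x))"
  proof (rule integrableI_nonneg)
    have "(\<integral>\<^sup>+x. ennreal (enn2real (multiplicity x)) \<partial>lebesgue) \<le> (\<integral>\<^sup>+x. multiplicity x \<partial>lebesgue)"
      by (intro nn_integral_mono) (auto simp: ennreal_enn2real_if)
    then show "(\<integral>\<^sup>+x. ennreal (enn2real (multiplicity x)) \<partial>lebesgue) < \<infinity>"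
      using nn_integral_multiplicity by simp
  qed auto
  then have "integrable lebesgue (\<lambda>x. indicator {a..b} x *\<^sub>R enn2real (multiplicity x))"
    by (intro integrable_mult_indicator) auto
  then have "integrable (lebesgue_on {a..b}) (\<lambda>x. enn2real (multiplicity x))"
    by (subst integrable_restrict_space) auto
  moreover have "integrable (lebesgue_on {a..b}) (\<lambda>x. 1 :: real)"
    by (subst integrable_restrict_space)
       (auto simp: integrable_indicator_iff emeasure_lborel_Icc_eq)
  ultimately show ?thesis
    unfolding exponent_def by (intro Bochner_Integration.integrable_add)
qed

lemma exponent_ge:
  assumes "multiplicity x \<noteq> \<infinity>" "\<And>i. i < n \<Longrightarrow> x \<in> U i"
  shows "1 + real n \<le> exponent x"
proof -
  have "of_nat n = (\<Sum>i<n. indicator (U i) x :: ennreal)"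
    using assms(2) by (simp add: indicator_def)
  also have "\<dots> \<le> multiplicity x"
    unfolding multiplicity_def by (rule sum_le_suminf) auto
  finally have "enn2real (of_nat n) \<le> enn2real (multiplicity x)"
    using assms(1) by (intro enn2real_mono) (auto simp: less_top)
  then show ?thesis
    by (simp add: exponent_def)
qed

lemma AE_exponent_ge:
  assumes "c \<in> C"
  shows "AE x in lebesgue. x \<in> cball c ((b - a) * (1 / 4) ^ n) \<longrightarrow> 1 + real n \<le> exponent x"
  using AE_multiplicity_finite
proof eventually_elim
  case (elim x)
  show ?case
  proof
    assume x: "x \<in> cball c ((b - a) * (1 / 4) ^ n)"
    have "x \<in> U i" if "i < n" for i
    proof -
      have "(b - a) * (1 / 4) ^ n \<le> (b - a) * (1 / 4) ^ i"
        using less that by (intro mult_left_mono power_decreasing) auto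
      with x have "x \<in> cball c ((b - a) * (1 / 4) ^ i)"
        by auto
      with cball_U[OF assms] show ?thesis
        by blast
    qed
    with elim show "1 + real n \<le> exponent x"
      by (rule exponent_ge)
  qed
qed

text \<open>Near any point of \<open>C\<close> there is an interval of positive length on which the exponent is
  almost everywhere larger than a given bound.\<close>

lemma esssup_exponent: "esssup (lebesgue_on {a..b}) (\<lambda>x. ereal (exponent x)) = \<infinity>"
proof (rule ereal_top)
  fix B :: real
  obtain c where "c \<in> C"
    using C_nonempty by blast
  with C_subset have c: "c \<in> C" "a < c" "c \<le> b"
    by auto
  define n where "n = nat \<lceil>B\<rceil>"
  have n: "B \<le> real n"
    unfolding n_def by linarith
  define s where "s = max a (c - (b - a) * (1 / 4) ^ n)"
  have "s < c"
    using less c by (simp add: s_def)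
  have "AE x in lebesgue_on {a..b}.
      ereal (exponent x) \<le> esssup (lebesgue_on {a..b}) (\<lambda>x. ereal (exponent x))"
    by (rule esssup_AE)
  then have "AE x in lebesgue. x \<in> {a..b} \<longrightarrow>
      ereal (exponent x) \<le> esssup (lebesgue_on {a..b}) (\<lambda>x. ereal (exponent x))"
    by (subst (asm) AE_restrict_space_iff) auto
  with AE_exponent_ge[OF c(1), of n] have "AE x in lebesgue. x \<in> {s..c} \<longrightarrow>
      ereal (1 + real n) \<le> esssup (lebesgue_on {a..b}) (\<lambda>x. ereal (exponent x))"
  proof eventually_elim
    case (elim x)
    show ?case
    proof
      assume "x \<in> {s..c}"
      then have "x \<in> {a..b}" "x \<in> cball c ((b - a) * (1 / 4) ^ n)"
        using c by (auto simp: s_def dist_real_def)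
      with elim have "1 + real n \<le> exponent x"
        "ereal (exponent x) \<le> esssup (lebesgue_on {a..b}) (\<lambda>x. ereal (exponent x))"
        by auto
      then show "ereal (1 + real n) \<le> esssup (lebesgue_on {a..b}) (\<lambda>x. ereal (exponent x))"
        by (meson ereal_less_eq(3) order_trans)
    qed
  qed
  then obtain x where "s \<le> x" "x \<le> c" "x \<in> {s..c} \<longrightarrow>
      ereal (1 + real n) \<le> esssup (lebesgue_on {a..b}) (\<lambda>x. ereal (exponent x))"
    using \<open>s < c\<close> by (rule AE_lebesgue_obtains_in_interval)
  then have "ereal (1 + real n) \<le> esssup (lebesgue_on {a..b}) (\<lambda>x. ereal (exponent x))"
    by simp
  moreover have "ereal B \<le> ereal (1 + real n)"
    using n by simp
  ultimately show "ereal B \<le> esssup (lebesgue_on {a..b}) (\<lambda>x. ereal (exponent x))"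
    by (rule order_trans[rotated])
qed

section \<open>The indicator function of the set\<close>

text \<open>Choose \<open>n\<close> such that the relative length \<open>(t - s) / (b - a)\<close> lies in
  \<open>((1/4) ^ (n + 1), (1/4) ^ n]\<close>. All points of the interval are then within
  \<open>(b - a) * (1/4) ^ n\<close> of a point of \<open>C\<close>, so its mean exponent is at least \<open>n + 1\<close>.\<close>

lemma mean_exponent_endpoint:
  assumes "s < t" "t - s \<le> b - a" "s \<in> C \<or> t \<in> C"
  shows "(1 / 4) powr mean_exponent exponent s t \<le> (t - s) / (b - a)"
proof -
  define d where "d = (t - s) / (b - a)"
  have d: "0 < d" "d \<le> 1"
    using assms less by (auto simp: d_def)
  define n where "n = (LEAST n. (1 / 4) ^ Suc n < d)"
  obtain k where "(1 / 4) ^ k < d"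
    using real_arch_pow_inv[OF d(1), of "1 / 4"] by auto
  then have "(1 / 4) ^ Suc k < d"
    by (simp add: power_Suc) (use d in linarith)
  then have n1: "(1 / 4) ^ Suc n < d"
    unfolding n_def by (rule LeastI)
  have n2: "d \<le> (1 / 4) ^ n"
  proof (cases n)
    case (Suc m)
    then have "\<not> (1 / 4) ^ Suc m < d"
      unfolding n_def by (intro not_less_Least) simp
    with Suc show ?thesis
      by simp
  qed (use d in simp)
  obtain c where c: "c \<in> C" "c \<in> {s, t}"
    using assms by auto
  have "t - s \<le> (b - a) * (1 / 4) ^ n"
    using n2 less by (simp add: d_def field_simps)
  then have "{s..t} \<subseteq> cball c ((b - a) * (1 / 4) ^ n)"
    using c by (auto simp: dist_real_def)
  with AE_exponent_ge[OF c(1), of n]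
  have "AE x in lebesgue. x \<in> {s..t} \<longrightarrow> 1 + real n \<le> exponent x"
    by (auto elim!: eventually_mono)
  then have "1 + real n \<le> mean_exponent exponent s t"
    using assms by (intro mean_exponent_ge) auto
  then have "(1 / 4) powr mean_exponent exponent s t \<le> (1 / 4) powr real (Suc n)"
    by (intro powr_mono') auto
  also have "\<dots> = (1 / 4) ^ Suc n"
    by (rule powr_realpow) simp
  finally show ?thesis
    using n1 unfolding d_def by linarith
qed

text \<open>Dividing by \<open>4\<close> makes the jumps equal to the ratio of consecutive radii. The relative
  lengths of the intervals of a partition add up to \<open>1\<close>.\<close>

lemma variation_indicator_le_1:
  "var_exp_variation a b exponent (\<lambda>x. indicator C x / 4) \<le> 1"
  unfolding var_exp_variation_def
proof (rule SUP_least, clarify)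
  fix n :: nat and t :: "nat \<Rightarrow> real"
  assume "(n, t) \<in> partitions a b"
  then have t: "t 0 = a" "t n = b" "\<And>k. k < n \<Longrightarrow> t k < t (Suc k)"
    by (auto simp: partitions_def)
  have mono: "t i \<le> t j" if "i \<le> j" "j \<le> n" for i j
    using that
  proof (induction j rule: dec_induct)
    case (step j)
    then show ?case
      using t(3)[of j] by simp
  qed simp
  have "(\<Sum>k<n. ennreal (\<bar>indicator C (t (Suc k)) / 4 - indicator C (t k) / 4\<bar>
          powr mean_exponent exponent (t k) (t (Suc k))))
      \<le> (\<Sum>k<n. ennreal ((t (Suc k) - t k) / (b - a)))"
  proof (intro sum_mono ennreal_leI)
    fix k assume "k \<in> {..<n}"
    then have k: "t k < t (Suc k)" "a \<le> t k" "t (Suc k) \<le> b"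
      using t(1,2) t(3)[of k] mono[of 0 k] mono[of "Suc k" n] by auto
    show "\<bar>indicator C (t (Suc k)) / 4 - indicator C (t k) / 4\<bar>
        powr mean_exponent exponent (t k) (t (Suc k)) \<le> (t (Suc k) - t k) / (b - a)"
    proof (cases "t k \<in> C \<longleftrightarrow> t (Suc k) \<in> C")
      case True
      then show ?thesis
        using k less by (auto simp: indicator_def)
    next
      case False
      then have "\<bar>indicator C (t (Suc k)) / 4 - indicator C (t k) / 4 :: real\<bar> = 1 / 4"
        by (auto simp: indicator_def)
      with False mean_exponent_endpoint[of "t k" "t (Suc k)"] k show ?thesis
        by auto
    qed
  qed
  also have "\<dots> = ennreal (\<Sum>k<n. (t (Suc k) - t k) / (b - a))"
    using t(3) less by (intro sum_ennreal) (auto intro!: divide_nonneg_pos less_imp_le)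
  also have "(\<Sum>k<n. (t (Suc k) - t k) / (b - a)) = 1"
    using t less by (simp add: sum_divide_distrib[symmetric] sum_lessThan_telescope)
  finally show "(\<Sum>k<n. ennreal (\<bar>indicator C (t (Suc k)) / 4 - indicator C (t k) / 4\<bar>
      powr mean_exponent exponent (t k) (t (Suc k)))) \<le> 1"
    by simp
qed

lemma indicator_in_WBV: "indicator C \<in> WBV a b exponent"
proof -
  have "wbv_norm a b exponent (indicator C) \<le> ennreal 4"
    unfolding wbv_norm_def using variation_indicator_le_1
    by (intro Inf_lower) (auto intro!: exI[of _ 4])
  also have "\<dots> < \<infinity>"
    by simp
  finally show ?thesis
    using C_subset by (auto simp: WBV_def indicator_def)
qed

text \<open>The multiplicity is infinite on \<open>C\<close>, which lies in every \<open>U n\<close>.\<close>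

lemma AE_notin_C: "AE x in lebesgue. x \<notin> C"
  using AE_multiplicity_finite
proof eventually_elim
  case (elim x)
  show ?case
  proof
    assume "x \<in> C"
    have "x \<in> U i" for i
      using cball_U[OF \<open>x \<in> C\<close>, of i] less by auto
    then have "1 + real n \<le> exponent x" for n
      using elim by (intro exponent_ge)
    from this[of "nat \<lceil>exponent x\<rceil>"] show False
      by linarith
  qed
qed

lemma C_subset_discontinuities: "C \<subseteq> discontinuities a b (indicator C)"
proof
  fix c assume "c \<in> C"
  then have c: "a < c" "c \<le> b"
    using C_subset by auto
  have "\<not> continuous (at c within {a..b}) (indicator C :: real \<Rightarrow> real)"
  proof
    assume "continuous (at c within {a..b}) (indicator C :: real \<Rightarrow> real)"
    then obtain d where d: "d > 0"
      "\<And>x. x \<in> {a..b} \<Longrightarrow> dist x c < d \<Longrightarrow> dist (indicator C x) (indicator C c :: real) < 1"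
      unfolding continuous_within_eps_delta by (metis zero_less_one)
    have "max a (c - d / 2) < c"
      using c d by auto
    with AE_notin_C obtain x where x: "max a (c - d / 2) \<le> x" "x \<le> c" "x \<notin> C"
      by (rule AE_lebesgue_obtains_in_interval)
    with c d(1) have "x \<in> {a..b}" "dist x c < d"
      by (auto simp: dist_real_def)
    from d(2)[OF this] x(3) \<open>c \<in> C\<close> show False
      by simp
  qed
  with c show "c \<in> discontinuities a b (indicator C)"
    by (simp add: discontinuities_def)
qed

end

section \<open>Sums of distinct powers of one quarter\<close>

definition quarter_sum :: "nat \<Rightarrow> nat set \<Rightarrow> real" where
  "quarter_sum n A = (\<Sum>i<n. if i \<in> A then (1 / 4) ^ Suc i else 0)"

definition quarter_series :: "nat set \<Rightarrow> real" where
  "quarter_series A = (\<Sum>i. if i \<in> A then (1 / 4) ^ Suc i else 0)"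

lemma quarter_sum_Int: "quarter_sum n (A \<inter> {..<n}) = quarter_sum n A"
  unfolding quarter_sum_def by (intro sum.cong) auto

text \<open>The remainder is at most \<open>(1/4) ^ (n + 1) + (1/4) ^ (n + 2) + \<dots> = (1/4) ^ n / 3\<close>.\<close>

lemma quarter_series_bounds:
  "quarter_sum n A \<le> quarter_series A" "quarter_series A \<le> quarter_sum n A + (1 / 4) ^ n / 3"
proof -
  let ?f = "\<lambda>i. if i \<in> A then (1 / 4) ^ Suc i else (0 :: real)"
  have geo: "(\<lambda>i. (1 / 4) ^ Suc (i + n) :: real) sums ((1 / 4) ^ n / 3)"
    using sums_mult[OF geometric_sums[of "1 / 4 :: real"], of "(1 / 4) ^ Suc n"]
    by (simp add: power_add mult_ac)
  have "summable (\<lambda>i. (1 / 4 :: real) ^ Suc i)"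
    by (simp add: summable_geometric)
  then have f: "summable ?f"
    by (rule summable_comparison_test') auto
  show "quarter_sum n A \<le> quarter_series A"
    unfolding quarter_sum_def quarter_series_def by (rule sum_le_suminf[OF f]) auto
  have "quarter_series A = (\<Sum>i. ?f (i + n)) + quarter_sum n A"
    unfolding quarter_sum_def quarter_series_def by (rule suminf_split_initial_segment[OF f])
  also have "(\<Sum>i. ?f (i + n)) \<le> (\<Sum>i. (1 / 4) ^ Suc (i + n))"
    using geo by (intro suminf_le summable_ignore_initial_segment f) (auto dest: sums_summable)
  also have "\<dots> = (1 / 4) ^ n / 3"
    using geo by (rule sums_unique[symmetric])
  finally show "quarter_series A \<le> quarter_sum n A + (1 / 4) ^ n / 3"
    by simp
qed

text \<open>The first index at which two sets differ decides the order of their sums, since the term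
  \<open>(1/4) ^ (n + 1)\<close> exceeds the sum \<open>(1/4) ^ (n + 1) / 3\<close> of all later terms.\<close>

lemma inj_quarter_series: "inj quarter_series"
proof (rule injI, rule ccontr)
  fix A B :: "nat set"
  assume eq: "quarter_series A = quarter_series B" and "A \<noteq> B"
  define n where "n = (LEAST n. (n \<in> A) \<noteq> (n \<in> B))"
  have n: "(n \<in> A) \<noteq> (n \<in> B)"
    unfolding n_def by (rule LeastI_ex) (use \<open>A \<noteq> B\<close> in blast)
  have "(i \<in> A) = (i \<in> B)" if "i < n" for i
    using that not_less_Least[of i "\<lambda>n. (n \<in> A) \<noteq> (n \<in> B)"] unfolding n_def by blast
  then have "quarter_sum n A = quarter_sum n B"
    unfolding quarter_sum_def by (intro sum.cong) auto
  then have "\<bar>quarter_sum (Suc n) A - quarter_sum (Suc n) B\<bar> = (1 / 4) ^ Suc n"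
    using n by (auto simp: quarter_sum_def)
  moreover have "(0 :: real) < (1 / 4) ^ Suc n"
    by simp
  ultimately show False
    using eq quarter_series_bounds[where n = "Suc n" and A = A]
      quarter_series_bounds[where n = "Suc n" and A = B]
    by linarith
qed

section \<open>A set of the cardinality of the continuum with thin neighbourhoods\<close>

text \<open>Measuring the sums from the right end keeps \<open>a\<close> out of the set, since all of them are at
  most \<open>1/3\<close>.\<close>

definition cantor_set :: "real \<Rightarrow> real \<Rightarrow> real set" where
  "cantor_set a b = range (\<lambda>A. b - (b - a) * quarter_series A)"

text \<open>The centres run over the truncated sums. As these are within \<open>(1/4) ^ n / 3\<close> of the full
  sums, the factor \<open>2\<close> in the radius makes these balls cover all balls of radius
  \<open>(b - a) * (1/4) ^ n\<close> around points of the Cantor set.\<close>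

definition cantor_nbhd :: "real \<Rightarrow> real \<Rightarrow> nat \<Rightarrow> real set" where
  "cantor_nbhd a b n =
     (\<Union>A \<in> Pow {..<n}. cball (b - (b - a) * quarter_sum n A) (2 * (b - a) * (1 / 4) ^ n))"

lemma cantor_set_eqpoll_reals:
  assumes "a < b"
  shows "cantor_set a b \<approx> (UNIV :: real set)"
proof -
  have "inj (\<lambda>A. b - (b - a) * quarter_series A)"
    using assms inj_quarter_series by (auto simp: inj_on_def)
  then have "cantor_set a b \<approx> (UNIV :: nat set set)"
    unfolding cantor_set_def by (rule inj_on_image_eqpoll_self)
  then show ?thesis
    using nat_sets_eqpoll_reals by (rule eqpoll_trans)
qed

lemma emeasure_cantor_nbhd:
  assumes "a < b"
  shows "emeasure lebesgue (cantor_nbhd a b n) \<le> ennreal (4 * (b - a) * (1 / 2) ^ n)"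
proof -
  let ?B = "\<lambda>A. cball (b - (b - a) * quarter_sum n A) (2 * (b - a) * (1 / 4) ^ n)"
  have "emeasure lebesgue (cantor_nbhd a b n) \<le> (\<Sum>A\<in>Pow {..<n}. emeasure lebesgue (?B A))"
    unfolding cantor_nbhd_def by (rule emeasure_subadditive_finite) auto
  also have "\<dots> = (\<Sum>A\<in>Pow {..<n}. ennreal (4 * (b - a) * (1 / 4) ^ n))"
    using assms by (intro sum.cong) (auto simp: cball_eq_atLeastAtMost)
  also have "\<dots> = of_nat (2 ^ n) * ennreal (4 * (b - a) * (1 / 4) ^ n)"
    by (simp add: card_Pow)
  also have "\<dots> = ennreal (2 ^ n * (4 * (b - a) * (1 / 4) ^ n))"
    using assms by (simp add: ennreal_of_nat_eq_real_of_nat ennreal_mult)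
  also have "2 ^ n * (4 * (b - a) * (1 / 4) ^ n) = 4 * (b - a) * (2 * (1 / 4)) ^ n"
    by (subst power_mult_distrib) simp
  finally show ?thesis
    by simp
qed

lemma thin_neighbourhoods_cantor:
  assumes "a < b"
  shows "thin_neighbourhoods a b (cantor_set a b) (cantor_nbhd a b)"
proof
  show "a < b"
    by fact
  show "cantor_set a b \<noteq> {}"
    by (simp add: cantor_set_def)
  show "cantor_set a b \<subseteq> {a<..b}"
  proof (clarsimp simp: cantor_set_def)
    fix A
    have A: "0 \<le> quarter_series A" "quarter_series A < 1"
      using quarter_series_bounds[where n = 0 and A = A] by (auto simp: quarter_sum_def)
    define d where "d = (b - a) * quarter_series A"
    have "d < (b - a) * 1"
      unfolding d_def using A assms by (intro mult_strict_left_mono) auto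
    moreover have "0 \<le> d"
      unfolding d_def using A assms by simp
    ultimately show "a < b - (b - a) * quarter_series A \<and> 0 \<le> (b - a) * quarter_series A"
      unfolding d_def[symmetric] by simp
  qed
  show "cantor_nbhd a b n \<in> sets lebesgue" for n
    unfolding cantor_nbhd_def by (intro sets.finite_UN) auto
  have "(\<Sum>n. emeasure lebesgue (cantor_nbhd a b n)) \<le> (\<Sum>n. ennreal (4 * (b - a) * (1 / 2) ^ n))"
    using emeasure_cantor_nbhd[OF assms] by (intro suminf_le) auto
  also have "\<dots> = ennreal (\<Sum>n. 4 * (b - a) * (1 / 2) ^ n)"
    using assms by (intro suminf_ennreal2 summable_mult summable_geometric) auto
  finally show "(\<Sum>n. emeasure lebesgue (cantor_nbhd a b n)) < \<infinity>"
    by (rule order_le_less_trans) simp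
  show "cball c ((b - a) * (1 / 4) ^ n) \<subseteq> cantor_nbhd a b n" if c: "c \<in> cantor_set a b" for c n
  proof
    fix x assume "x \<in> cball c ((b - a) * (1 / 4) ^ n)"
    then have x: "\<bar>x - c\<bar> \<le> (b - a) * (1 / 4) ^ n"
      by (simp add: dist_real_def abs_minus_commute)
    obtain A where A: "c = b - (b - a) * quarter_series A"
      using c by (auto simp: cantor_set_def)
    let ?c = "b - (b - a) * quarter_sum n (A \<inter> {..<n})"
    have "?c - c = (b - a) * (quarter_series A - quarter_sum n A)"
      by (simp add: A quarter_sum_Int algebra_simps)
    moreover have "\<bar>quarter_series A - quarter_sum n A\<bar> \<le> (1 / 4) ^ n"
      using quarter_series_bounds[where n = n and A = A] zero_le_power[of "1 / 4 :: real" n] by linarith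
    ultimately have "\<bar>?c - c\<bar> \<le> (b - a) * (1 / 4) ^ n"
      using assms by (simp add: abs_mult del: power_divide)
    with x have "dist ?c x \<le> 2 * (b - a) * (1 / 4) ^ n"
      unfolding dist_real_def by linarith
    then show "x \<in> cantor_nbhd a b n"
      unfolding cantor_nbhd_def by (intro UN_I[of "A \<inter> {..<n}"]) auto
  qed
qed

section \<open>Uncountably many discontinuities\<close>

theorem theorem2p11:
  fixes a b :: real
  assumes "a < b"
  shows "\<exists>p f :: real \<Rightarrow> real.
           (\<forall>x\<in>{a..b}. 1 \<le> p x) \<and>
           integrable (lebesgue_on {a..b}) p \<and>
           esssup (lebesgue_on {a..b}) (\<lambda>x. ereal (p x)) = \<infinity> \<and>
           f \<in> WBV a b p \<and>
           discontinuities a b f \<approx> (UNIV :: real set)"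
proof -
  interpret thin_neighbourhoods a b "cantor_set a b" "cantor_nbhd a b"
    using assms by (rule thin_neighbourhoods_cantor)
  let ?D = "discontinuities a b (indicator (cantor_set a b))"
  have "(UNIV :: real set) \<lesssim> cantor_set a b"
    using cantor_set_eqpoll_reals[OF assms] by (blast intro: eqpoll_imp_lepoll eqpoll_sym)
  also have "cantor_set a b \<lesssim> ?D"
    using C_subset_discontinuities by (rule subset_imp_lepoll)
  finally have "?D \<approx> (UNIV :: real set)"
    by (intro lepoll_antisym[OF subset_imp_lepoll]) auto
  then show ?thesis
    using integrable_exponent esssup_exponent indicator_in_WBV
    by (intro exI[of _ exponent] exI[of _ "indicator (cantor_set a b)"]) (simp add: exponent_def)
qed

end
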